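(* Consider Scheme 3-p (probabilistic mode selection, D2D links always active). Its operational region equals $\mathcal R^{\text{3-p}}=\mathcal R^{1}\cup\hat{\mathcal R}^{\text{3-p}}$, where: Overlay D2D: $\mathcal R^1=\{c_1>e^{c_2}\}$ and $$\hat{\mathcal R}^{\text{3-p}}=\left\{c_2e<c_1<\frac{e^{c_2}}{2-c_2},\ 1<c_2<2\right\}\cup\{c_2e<c_1,\ c_2\ge 2\}.$$ Underlay D2D: $\mathcal R^1=\{\bar c_1>e^{\bar c_2+\bar c_3}\}$ and $$\hat{\mathcal R}^{\text{3-p}}=\left\{e^{\bar c_3}<\bar c_1<\frac{e^{\bar c_2+\bar c_3}}{1-\bar c_2},\ \bar c_2<1\right\}\cup\{e^{\bar c_3}<\bar c_1,\ \bar c_2\ge 1\}.$$ For operational points in $\hat{\mathcal R}^{\text{3-p}}$ the rate-maximizing D2D mode selection probability is $p^*=x^*/c_2<1$ for overlay and $p^*=x^*/\bar c_2<1$ for underlay, where $x^*$ is the unique solution of $xe^{-x}(2-x)=c_2/c_1$ with $1<x<\min\{2,c_2\}$ in the overlay case, and of $e^{-x}(1-x)=e^{\bar c_3}/\bar c_1$ with $0<x<\min\{1,\bar c_2\}$ in the underlay case. For all other operational points of $\mathcal R^{\text{3-p}}$, $p^*=1$.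
   Context: A D2D-enabled cellular network has D2D mode selection probability $p\in(0,1]$; in Scheme 3 the D2D channel access probability is fixed to $1$. The average user rate is $R=R_{\mathrm{noD2D}}(1+wf(p))$ with $R_{\mathrm{noD2D}},w>0$ independent of $p$, where for probabilistic mode selection $$f(p)=c_1p^2e^{-c_2p}-p\ \text{ (overlay)},\qquad f(p)=\bar c_1p\,e^{-(\bar c_2p+\bar c_3)}-p\ \text{ (underlay)}.$$ The operational point is encoded by $(c_1,c_2)\in(0,\infty)^2$ (overlay) or $(\bar c_1,\bar c_2,\bar c_3)\in(0,\infty)^3$ (underlay); all displayed sets are subsets of $(0,\infty)^2$, respectively $(0,\infty)^3$. The operational region $\mathcal R^{\text{3-p}}$ is the set of operational points for which some $p\in(0,1]$ gives $R>R_{\mathrm{noD2D}}$, i.e. $f(p)>0$. $p^*$ is the maximizer of $R$ (equivalently of $f$) over $p\in(0,1]$. $\mathcal R^1$ is the operational region of the baseline scheme with $p=1$. *)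

theory Defs
  imports Complex_Main
begin

definition avg_rate :: "real \<Rightarrow> real \<Rightarrow> (real \<Rightarrow> real) \<Rightarrow> real \<Rightarrow> real" where
  "avg_rate R0 w f p = R0 * (1 + w * f p)"

definition overlay_points :: "(real \<times> real) set" where
  "overlay_points = {(c1, c2). c1 > 0 \<and> c2 > 0}"

definition underlay_points :: "(real \<times> real \<times> real) set" where
  "underlay_points = {(c1, c2, c3). c1 > 0 \<and> c2 > 0 \<and> c3 > 0}"

fun f_overlay :: "real \<times> real \<Rightarrow> real \<Rightarrow> real" where
  "f_overlay (c1, c2) p = c1 * p\<^sup>2 * exp (- c2 * p) - p"

fun f_underlay :: "real \<times> real \<times> real \<Rightarrow> real \<Rightarrow> real" where
  "f_underlay (c1, c2, c3) p = c1 * p * exp (- (c2 * p + c3)) - p"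

text \<open>
  Operational points in \<open>\<Theta>\<close> at which some mode selection probability in \<open>P\<close> beats
  the rate without D2D. The constants \<open>R0\<close> and \<open>w\<close> do not depend on the
  probability, but they may vary with the operational point.
\<close>
definition operational_region ::
  "real set \<Rightarrow> 'a set \<Rightarrow> ('a \<Rightarrow> real) \<Rightarrow> ('a \<Rightarrow> real) \<Rightarrow> ('a \<Rightarrow> real \<Rightarrow> real) \<Rightarrow> 'a set" where
  "operational_region P \<Theta> R0 w f =
     {\<theta> \<in> \<Theta>. \<exists>p\<in>P. avg_rate (R0 \<theta>) (w \<theta>) (f \<theta>) p > R0 \<theta>}"

abbreviation region_3p ::
  "'a set \<Rightarrow> ('a \<Rightarrow> real) \<Rightarrow> ('a \<Rightarrow> real) \<Rightarrow> ('a \<Rightarrow> real \<Rightarrow> real) \<Rightarrow> 'a set" where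
  "region_3p \<equiv> operational_region {0<..1}"

abbreviation region_baseline ::
  "'a set \<Rightarrow> ('a \<Rightarrow> real) \<Rightarrow> ('a \<Rightarrow> real) \<Rightarrow> ('a \<Rightarrow> real \<Rightarrow> real) \<Rightarrow> 'a set" where
  "region_baseline \<equiv> operational_region {1}"

text \<open>
  All maximizers, so that \<open>p\<^sup>*\<close> being equal to \<open>q\<close> is expressed as
  \<open>rate_maximizers \<dots> = {q}\<close>; this includes existence and uniqueness.
\<close>
definition rate_maximizers :: "real \<Rightarrow> real \<Rightarrow> (real \<Rightarrow> real) \<Rightarrow> real set" where
  "rate_maximizers R0 w f = {p. is_arg_max (avg_rate R0 w f) (\<lambda>p. p \<in> {0<..1}) p}"

definition hat_overlay :: "(real \<times> real) set" where
  "hat_overlay =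
     {(c1, c2) \<in> overlay_points. c2 * exp 1 < c1 \<and> c1 < exp c2 / (2 - c2) \<and> 1 < c2 \<and> c2 < 2} \<union>
     {(c1, c2) \<in> overlay_points. c2 * exp 1 < c1 \<and> c2 \<ge> 2}"

definition hat_underlay :: "(real \<times> real \<times> real) set" where
  "hat_underlay =
     {(c1, c2, c3) \<in> underlay_points.
        exp c3 < c1 \<and> c1 < exp (c2 + c3) / (1 - c2) \<and> c2 < 1} \<union>
     {(c1, c2, c3) \<in> underlay_points. exp c3 < c1 \<and> c2 \<ge> 1}"

definition stationary_overlay :: "real \<times> real \<Rightarrow> real \<Rightarrow> bool" where
  "stationary_overlay = (\<lambda>(c1, c2) x.
     1 < x \<and> x < min 2 c2 \<and> x * exp (- x) * (2 - x) = c2 / c1)"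

definition stationary_underlay :: "real \<times> real \<times> real \<Rightarrow> real \<Rightarrow> bool" where
  "stationary_underlay = (\<lambda>(c1, c2, c3) x.
     0 < x \<and> x < min 1 c2 \<and> exp (- x) * (1 - x) = exp c3 / c1)"

end

theory Submission
  imports Defs
begin

text \<open>
  Rescaling \<open>x = c2 * p\<close> turns \<open>f\<close> into a positive multiple of \<open>G x - k * x\<close> on
  \<open>(0, c2]\<close>, where \<open>G x = x\<^sup>2 * exp (- x)\<close>, \<open>k = c2 / c1\<close> for overlay and
  \<open>G x = x * exp (- x)\<close>, \<open>k = exp c3 / c1\<close> for underlay. The derivative \<open>g\<close> of \<open>G\<close>
  is strictly decreasing on \<open>[a, b]\<close> (\<open>[1, 2]\<close>, respectively \<open>[0, 1]\<close>) and negative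
  beyond \<open>b\<close>, so the peak over \<open>[a, c2]\<close> is the root of \<open>g x = k\<close> if \<open>g\<close> falls
  below \<open>k\<close> before \<open>c2\<close>, and the right end point otherwise. For overlay the points
  \<open>x < min 1 c2\<close> lose against \<open>min 1 c2\<close>, because \<open>G x - k * x = x * (x * exp (- x) - k)\<close> and
  \<open>x * exp (- x)\<close> increases up to its maximum at \<open>1\<close>.
\<close>

section \<open>From rates to gains, and rescaling of the probability\<close>

lemma operational_region_gain:
  assumes "\<And>\<theta>. \<theta> \<in> \<Theta> \<Longrightarrow> R0 \<theta> > 0 \<and> w \<theta> > 0"
  shows "operational_region P \<Theta> R0 w f = {\<theta> \<in> \<Theta>. \<exists>p\<in>P. f \<theta> p > 0}"
proof -
  have "avg_rate (R0 \<theta>) (w \<theta>) (f \<theta>) p > R0 \<theta> \<longleftrightarrow> f \<theta> p > 0" if "\<theta> \<in> \<Theta>" for \<theta> p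
    using assms[OF that] by (simp add: avg_rate_def distrib_left zero_less_mult_iff)
  then show ?thesis
    unfolding operational_region_def by blast
qed

text \<open>The rate is an increasing affine function of \<open>f\<close>, and \<open>p\<close> to
  \<open>c * p\<close> maps (0, 1] onto (0, c]. The peak is required to be strict, so that the
  maximizer comes out as a singleton.\<close>

lemma rate_maximizers_rescale:
  assumes "R0 > 0" "w > 0" "A > 0" "c > 0"
    and f: "\<And>p. f p = A * H (c * p)"
    and x: "0 < x" "x \<le> c"
    and peak: "\<And>y. 0 < y \<Longrightarrow> y \<le> c \<Longrightarrow> y \<noteq> x \<Longrightarrow> H y < H x"
  shows "rate_maximizers R0 w f = {x / c}"
proof -
  have less: "avg_rate R0 w f p < avg_rate R0 w f q \<longleftrightarrow> f p < f q" for p q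
    using assms(1,2) by (simp add: avg_rate_def)
  have mem: "x / c \<in> {0<..1}"
    using x \<open>c > 0\<close> by simp
  have "f p < f (x / c)" if "p \<in> {0<..1}" "p \<noteq> x / c" for p
  proof -
    have "0 < c * p" "c * p \<le> c" "c * p \<noteq> x"
      using that \<open>c > 0\<close> by (auto simp: mult_le_cancel_left1)
    then show ?thesis
      using peak[of "c * p"] \<open>A > 0\<close> \<open>c > 0\<close> by (simp add: f)
  qed
  moreover have "rate_maximizers R0 w f = {p \<in> {0<..1}. \<forall>q\<in>{0<..1}. \<not> f p < f q}"
    unfolding rate_maximizers_def is_arg_max_def less by blast
  ultimately show ?thesis
    using mem less_asym by blast
qed

section \<open>Calculus for the rescaled problem\<close>

text \<open>The derivative \<open>g t - k\<close> is positive before \<open>x\<close> and negative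
  after it. The two conditions on \<open>g x\<close> cover both kinds of peak at once: an interior
  root of \<open>g x = k\<close>, or the right end \<open>x = c\<close> where the slope may still
  exceed \<open>k\<close>. In \<open>anti\<close> only \<open>s\<close> is bounded by
  \<open>b\<close>, so points beyond \<open>b\<close> are compared as well.\<close>

lemma concave_peak:
  fixes G g :: "real \<Rightarrow> real"
  assumes deriv: "\<And>t. (G has_real_derivative g t) (at t)"
    and anti: "\<And>s t. a \<le> s \<Longrightarrow> s \<le> b \<Longrightarrow> s < t \<Longrightarrow> g t < g s"
    and x: "a \<le> x" "x \<le> b" and "k \<le> g x" "x < c \<Longrightarrow> g x = k"
    and y: "a \<le> y" "y \<le> c" "y \<noteq> x"
  shows "G y - k * y < G x - k * x"
proof -
  have D: "((\<lambda>t. G t - k * t) has_real_derivative g t - k) (at t)" for t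
    by (rule derivative_eq_intros deriv refl | simp)+
  have cont: "continuous_on S (\<lambda>t. G t - k * t)" for S
    using D DERIV_isCont continuous_at_imp_continuous_on by blast
  show ?thesis
  proof (cases "y < x")
    case True
    show ?thesis
    proof (rule DERIV_pos_imp_increasing_open[OF True _ cont])
      fix t assume "y < t" "t < x"
      then have "g t - k > 0"
        using anti[of t x] x y \<open>k \<le> g x\<close> by auto
      then show "\<exists>d. ((\<lambda>t. G t - k * t) has_real_derivative d) (at t) \<and> d > 0"
        using D by blast
    qed
  next
    case False
    then have "x < y" and "g x = k"
      using y assms(6) by auto
    show ?thesis
    proof (rule DERIV_neg_imp_decreasing_open[OF \<open>x < y\<close> _ cont])
      fix t assume "x < t" "t < y"
      then have "g t - k < 0"
        using anti[of x t] x \<open>g x = k\<close> by auto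
      then show "\<exists>d. ((\<lambda>t. G t - k * t) has_real_derivative d) (at t) \<and> d < 0"
        using D by blast
    qed
  qed
qed

lemma strict_decreasing_unique_root:
  fixes g :: "real \<Rightarrow> real"
  assumes cont: "continuous_on {a..b} g"
    and anti: "\<And>s t. a \<le> s \<Longrightarrow> s < t \<Longrightarrow> t \<le> b \<Longrightarrow> g t < g s"
    and "a \<le> b" "k < g a" "g b < k"
  shows "\<exists>!x. a < x \<and> x < b \<and> g x = k"
proof -
  obtain x where "a \<le> x" "x \<le> b" "g x = k"
    using IVT2'[of g b k a] assms by auto
  moreover have "x \<noteq> a" "x \<noteq> b"
    using \<open>g x = k\<close> assms(4,5) by auto
  moreover have "y = x" if "a < y" "y < b" "g y = k" for y
    using anti[of x y] anti[of y x] that calculation by (cases x y rule: linorder_cases) auto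
  ultimately show ?thesis
    by (intro ex1I[of _ x]) auto
qed

text \<open>The tangent bound \<open>exp u >= 1 + u\<close> at \<open>u = x - m\<close>, with
  \<open>m = min 1 c\<close>, reduces the claim to an inequality linear in \<open>x\<close>.\<close>

lemma mult_exp_minus_le:
  fixes x c :: real
  assumes "0 < x" "x \<le> c"
  shows "x * exp (- x) \<le> min 1 c * exp (- min 1 c)"
proof -
  define m where "m = min 1 c"
  have m: "0 < m" "m \<le> 1" and mx: "m = 1 \<or> x \<le> m"
    using assms by (auto simp: m_def)
  have "x \<le> m * (1 + (x - m))"
  proof -
    \<comment> \<open>This product is the difference of the two sides. Either its first factor
      vanishes or both factors are nonnegative.\<close>
    have "(1 - m) * (m - x) \<ge> 0"
      using m mx by auto
    then show ?thesis
      by (simp add: algebra_simps)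
  qed
  also have "\<dots> \<le> m * exp (x - m)"
    using m exp_ge_add_one_self[of "x - m"] by simp
  finally show ?thesis
    unfolding m_def[symmetric] by (simp add: exp_diff exp_minus field_simps)
qed

section \<open>Slopes of the rescaled gains and their peaks\<close>

definition overlay_slope :: "real \<Rightarrow> real" where
  "overlay_slope x = x * exp (- x) * (2 - x)"

definition underlay_slope :: "real \<Rightarrow> real" where
  "underlay_slope x = exp (- x) * (1 - x)"

lemma overlay_slope_deriv:
  "((\<lambda>x. x\<^sup>2 * exp (- x)) has_real_derivative overlay_slope x) (at x)"
  unfolding overlay_slope_def
  by (auto intro!: derivative_eq_intros simp: algebra_simps power2_eq_square)

lemma underlay_slope_deriv:
  "((\<lambda>x. x * exp (- x)) has_real_derivative underlay_slope x) (at x)"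
  unfolding underlay_slope_def
  by (auto intro!: derivative_eq_intros simp: algebra_simps)

text \<open>The polynomial factor \<open>x * (2 - x)\<close> falls from \<open>1\<close> on. It is
  compared first under the common weight \<open>exp (- t)\<close>; the weight is then raised to
  \<open>exp (- s)\<close>, which is safe because \<open>s * (2 - s)\<close> is nonnegative,
  whatever the sign at \<open>t\<close>.\<close>

lemma overlay_slope_less:
  assumes "1 \<le> s" "s \<le> 2" "s < t"
  shows "overlay_slope t < overlay_slope s"
proof -
  have poly: "t * (2 - t) < s * (2 - s)"
  proof -
    have "(t - s) * (t + s - 2) > 0"
      using assms by (intro mult_pos_pos) auto
    then show ?thesis
      by (simp add: algebra_simps)
  qed
  have "exp (- t) * (t * (2 - t)) < exp (- s) * (s * (2 - s))"
  proof -
    have "exp (- t) * (t * (2 - t)) < exp (- t) * (s * (2 - s))"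
      using poly by simp
    also have "\<dots> \<le> exp (- s) * (s * (2 - s))"
      using assms by (intro mult_right_mono) auto
    finally show ?thesis .
  qed
  then show ?thesis
    by (simp add: overlay_slope_def mult_ac)
qed

lemma underlay_slope_less:
  assumes "s \<le> 1" "s < t"
  shows "underlay_slope t < underlay_slope s"
proof -
  have "exp (- t) * (1 - t) < exp (- t) * (1 - s)"
    using assms by simp
  also have "\<dots> \<le> exp (- s) * (1 - s)"
    using assms by (intro mult_right_mono) auto
  finally show ?thesis
    by (simp add: underlay_slope_def)
qed

lemma overlay_peak:
  fixes c k x y :: real
  assumes gain: "k < min 1 c * exp (- min 1 c)"
    and x: "min 1 c \<le> x" "x \<le> c" "x \<le> 2"
    and slope: "k \<le> overlay_slope x" "x < c \<Longrightarrow> overlay_slope x = k"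
    and y: "0 < y" "y \<le> c" "y \<noteq> x"
  shows "y\<^sup>2 * exp (- y) - k * y < x\<^sup>2 * exp (- x) - k * x"
proof -
  define m where "m = min 1 c"
  define H where "H = (\<lambda>y::real. y\<^sup>2 * exp (- y) - k * y)"
  have H_factor: "H y = y * (y * exp (- y) - k)" for y
    by (simp add: H_def algebra_simps power2_eq_square)
  \<comment> \<open>For \<open>c < 1\<close> the range from \<open>m = c\<close> to \<open>c\<close>
    is the single point \<open>x\<close>, so only \<open>c >= 1\<close> with \<open>m = 1\<close>
    needs the slope argument.\<close>
  have above: "H y < H x" if "m \<le> y" "y \<le> c" "y \<noteq> x" for y
  proof (cases "1 \<le> c")
    case True
    then show ?thesis
      unfolding H_def using that x slope
      by (intro concave_peak[OF overlay_slope_deriv, where a = 1 and b = 2 and c = c])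
         (auto simp: m_def overlay_slope_less)
  next
    case False
    then show ?thesis
      using that x by (auto simp: m_def)
  qed
  have "H y < H x"
  proof (cases "y < m")
    case True
    \<comment> \<open>First the bracket is raised to its value at \<open>m\<close>; this value is
      positive by \<open>gain\<close>, so enlarging the outer factor from \<open>y\<close> to
      \<open>m\<close> increases the product strictly.\<close>
    have "H y \<le> y * (m * exp (- m) - k)"
      unfolding H_factor using mult_exp_minus_le[OF y(1,2)] y(1)
      by (intro mult_left_mono) (auto simp: m_def)
    also have "\<dots> < m * (m * exp (- m) - k)"
      using True gain by (intro mult_strict_right_mono) (auto simp: m_def)
    also have "\<dots> = H m"
      by (simp add: H_factor)
    also have "\<dots> \<le> H x"
      using above[of m] by (cases "m = x") (auto simp: m_def)
    finally show ?thesis .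
  next
    case False
    then show ?thesis
      using above y by auto
  qed
  then show ?thesis
    by (simp add: H_def)
qed

text \<open>Here the slope already decreases from \<open>0\<close> on, so
  \<open>concave_peak\<close> reaches every \<open>y > 0\<close> directly.\<close>

lemma underlay_peak:
  fixes c k x y :: real
  assumes "0 \<le> x" "x \<le> 1"
    and "k \<le> underlay_slope x" "x < c \<Longrightarrow> underlay_slope x = k"
    and "0 < y" "y \<le> c" "y \<noteq> x"
  shows "y * exp (- y) - k * y < x * exp (- x) - k * x"
  using assms
  by (intro concave_peak[OF underlay_slope_deriv, where a = 0 and b = 1 and c = c])
     (auto simp: underlay_slope_less)

section \<open>Rescaled form and positivity of the gain\<close>

lemma f_overlay_rescale:
  assumes "c1 > 0" "c2 > 0"
  shows "f_overlay (c1, c2) p =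
    c1 / c2\<^sup>2 * ((c2 * p)\<^sup>2 * exp (- (c2 * p)) - c2 / c1 * (c2 * p))"
  using assms by (simp add: field_simps power2_eq_square)

lemma f_underlay_rescale:
  assumes "c1 > 0" "c2 > 0"
  shows "f_underlay (c1, c2, c3) p =
    c1 * exp (- c3) / c2 * ((c2 * p) * exp (- (c2 * p)) - exp c3 / c1 * (c2 * p))"
  using assms by (simp add: exp_minus exp_add exp_diff divide_simps) (simp add: algebra_simps)

lemma f_overlay_pos_iff:
  assumes "c1 > 0" "c2 > 0" "p > 0"
  shows "f_overlay (c1, c2) p > 0 \<longleftrightarrow> c2 / c1 < (c2 * p) * exp (- (c2 * p))"
proof -
  have "f_overlay (c1, c2) p = (c1 * p / c2) * ((c2 * p) * exp (- (c2 * p)) - c2 / c1)"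
    using assms by (simp add: field_simps power2_eq_square)
  moreover have "c1 * p / c2 > 0"
    using assms by simp
  ultimately show ?thesis
    by (metis diff_gt_0_iff_gt zero_less_mult_pos mult_pos_pos)
qed

lemma f_underlay_pos_iff:
  assumes "c1 > 0" "p > 0"
  shows "f_underlay (c1, c2, c3) p > 0 \<longleftrightarrow> exp (c2 * p + c3) < c1"
proof -
  have "f_underlay (c1, c2, c3) p = p * exp (- (c2 * p + c3)) * (c1 - exp (c2 * p + c3))"
    by (simp add: algebra_simps flip: exp_add)
  moreover have "p * exp (- (c2 * p + c3)) > 0"
    using assms by simp
  ultimately show ?thesis
    by (metis diff_gt_0_iff_gt zero_less_mult_pos mult_pos_pos)
qed

text \<open>The sign of \<open>f\<close> is that of \<open>x * exp (- x) - c2 / c1\<close> at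
  \<open>x = c2 * p\<close>, so it suffices to test the maximum over (0, c2], attained at
  \<open>x = min 1 c2\<close>.\<close>

lemma f_overlay_gain_iff:
  assumes "c1 > 0" "c2 > 0"
  shows "(\<exists>p\<in>{0<..1}. f_overlay (c1, c2) p > 0) \<longleftrightarrow>
    c2 / c1 < min 1 c2 * exp (- min 1 c2)"
proof
  assume "\<exists>p\<in>{0<..1}. f_overlay (c1, c2) p > 0"
  then obtain p where p: "0 < p" "p \<le> 1" "f_overlay (c1, c2) p > 0"
    by auto
  then have "c2 / c1 < (c2 * p) * exp (- (c2 * p))"
    using f_overlay_pos_iff[OF assms] by blast
  also have "\<dots> \<le> min 1 c2 * exp (- min 1 c2)"
    using p assms by (intro mult_exp_minus_le) (auto simp: mult_le_cancel_left1)
  finally show "c2 / c1 < min 1 c2 * exp (- min 1 c2)" .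
next
  assume gain: "c2 / c1 < min 1 c2 * exp (- min 1 c2)"
  have "min 1 c2 / c2 \<in> {0<..1}"
    using assms by auto
  moreover have "f_overlay (c1, c2) (min 1 c2 / c2) > 0"
    using gain assms by (subst f_overlay_pos_iff) auto
  ultimately show "\<exists>p\<in>{0<..1}. f_overlay (c1, c2) p > 0" ..
qed

text \<open>The ratio \<open>f p / p\<close> decreases in \<open>p\<close>, and the bound is its
  limit condition as \<open>p\<close> tends to \<open>0\<close>; a sufficiently small
  \<open>p\<close> is therefore the witness.\<close>

lemma f_underlay_gain_iff:
  assumes "c1 > 0" "c2 > 0"
  shows "(\<exists>p\<in>{0<..1}. f_underlay (c1, c2, c3) p > 0) \<longleftrightarrow> exp c3 < c1"
proof
  assume "\<exists>p\<in>{0<..1}. f_underlay (c1, c2, c3) p > 0"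
  then obtain p where p: "0 < p" "f_underlay (c1, c2, c3) p > 0"
    by auto
  then have "exp (c2 * p + c3) < c1"
    using f_underlay_pos_iff[OF assms(1)] by blast
  moreover have "exp c3 \<le> exp (c2 * p + c3)"
    using p assms by simp
  ultimately show "exp c3 < c1"
    by linarith
next
  assume "exp c3 < c1"
  \<comment> \<open>Half of the logarithmic gap keeps \<open>c2 * p + c3\<close> strictly below
    \<open>ln c1\<close> once \<open>c2 * p <= d\<close>.\<close>
  define d where "d = (ln c1 - c3) / 2"
  have "c3 < ln c1"
    using \<open>exp c3 < c1\<close> assms by (metis exp_less_cancel_iff exp_ln)
  then have d: "d > 0" "d + c3 < ln c1"
    by (auto simp: d_def field_simps)
  define p where "p = min 1 (d / c2)"
  have p: "p \<in> {0<..1}"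
    using d assms by (simp add: p_def)
  have "c2 * p \<le> d"
    using assms by (simp add: p_def min_def field_simps)
  then have "exp (c2 * p + c3) < exp (ln c1)"
    using d by simp
  then have "f_underlay (c1, c2, c3) p > 0"
    using p assms by (subst f_underlay_pos_iff) auto
  with p show "\<exists>p\<in>{0<..1}. f_underlay (c1, c2, c3) p > 0" ..
qed

lemma f_overlay_one_pos_iff: "f_overlay (c1, c2) 1 > 0 \<longleftrightarrow> exp c2 < c1"
  by (simp add: exp_minus field_simps)

lemma f_underlay_one_pos_iff: "f_underlay (c1, c2, c3) 1 > 0 \<longleftrightarrow> exp (c2 + c3) < c1"
  by (simp add: exp_minus exp_diff exp_add field_simps)

section \<open>The hat regions as slope conditions\<close>

text \<open>Since \<open>exp (- 1)\<close> is the slope at \<open>1\<close>, the last two conditions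
  say that the slope crosses \<open>c2 / c1\<close> between \<open>1\<close> and
  \<open>min 2 c2\<close>. The branch \<open>c2 >= 2\<close> fits in because the slope vanishes at
  \<open>2\<close>.\<close>

lemma mem_hat_overlay_iff:
  assumes "c1 > 0" "c2 > 0"
  shows "(c1, c2) \<in> hat_overlay \<longleftrightarrow>
    1 < c2 \<and> c2 / c1 < exp (- 1) \<and> overlay_slope (min 2 c2) < c2 / c1"
proof -
  have A: "c2 / c1 < exp (- 1) \<longleftrightarrow> c2 * exp 1 < c1"
    using assms by (simp add: exp_minus field_simps)
  have B: "overlay_slope (min 2 c2) < c2 / c1 \<longleftrightarrow> c1 < exp c2 / (2 - c2)" if "c2 < 2"
  proof -
    have "overlay_slope c2 < c2 / c1 \<longleftrightarrow> c2 * (c1 * (2 - c2)) < c2 * exp c2"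
      using assms by (simp add: overlay_slope_def exp_minus field_simps)
    also have "\<dots> \<longleftrightarrow> c1 < exp c2 / (2 - c2)"
      using assms that by (simp add: pos_less_divide_eq)
    finally show ?thesis
      using that by simp
  qed
  have C: "overlay_slope (min 2 c2) < c2 / c1" if "2 \<le> c2"
    using that assms by (simp add: overlay_slope_def)
  show ?thesis
    using A B C assms by (cases "c2 < 2") (auto simp: hat_overlay_def overlay_points_def)
qed

lemma mem_hat_underlay_iff:
  assumes "c1 > 0" "c2 > 0" "c3 > 0"
  shows "(c1, c2, c3) \<in> hat_underlay \<longleftrightarrow>
    exp c3 / c1 < 1 \<and> underlay_slope (min 1 c2) < exp c3 / c1"
proof -
  have B: "underlay_slope (min 1 c2) < exp c3 / c1 \<longleftrightarrow> c1 < exp (c2 + c3) / (1 - c2)"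
    if "c2 < 1"
    using assms that
    by (simp add: underlay_slope_def exp_minus exp_add field_simps)
  have C: "underlay_slope (min 1 c2) < exp c3 / c1" if "1 \<le> c2"
    using that assms by (simp add: underlay_slope_def)
  show ?thesis
    using B C assms by (cases "c2 < 1") (auto simp: hat_underlay_def underlay_points_def)
qed

text \<open>For \<open>c2 <= 1\<close> the hat region has no points and both sides read
  \<open>exp c2 < c1\<close>. For \<open>c2 > 1\<close> the baseline region lies inside the gain
  region, and a gain point outside the baseline satisfies the slope condition.\<close>

lemma overlay_gain_cases:
  assumes "c1 > 0" "c2 > 0"
  shows "c2 / c1 < min 1 c2 * exp (- min 1 c2) \<longleftrightarrow>
    exp c2 < c1 \<or> (c1, c2) \<in> hat_overlay"
proof (cases "1 < c2")
  case False
  then show ?thesis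
    using assms by (simp add: mem_hat_overlay_iff exp_minus field_simps)
next
  case True
  have R1: "c2 / c1 < exp (- 1)" if "exp c2 < c1"
  proof -
    \<comment> \<open>The bound \<open>c2 <= exp (c2 - 1)\<close> is the tangent bound at
      \<open>c2 - 1\<close>.\<close>
    have "c2 * exp 1 \<le> exp (c2 - 1) * exp 1"
      using exp_ge_add_one_self[of "c2 - 1"] by simp
    also have "\<dots> < c1"
      using that by (simp flip: exp_add)
    finally show ?thesis
      using assms by (simp add: exp_minus field_simps)
  qed
  have hat: "overlay_slope (min 2 c2) < c2 / c1" if "c1 \<le> exp c2"
  proof (cases "c2 < 2")
    case True
    have "c1 * exp (- c2) * (2 - c2) \<le> 1 * (2 - c2)"
      using that True assms by (intro mult_right_mono) (auto simp: exp_minus field_simps)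
    also have "\<dots> < 1"
      using \<open>1 < c2\<close> by simp
    finally have "c2 * (c1 * exp (- c2) * (2 - c2)) < c2 * 1"
      using assms by (intro mult_strict_left_mono) auto
    then show ?thesis
      using True assms by (simp add: overlay_slope_def pos_less_divide_eq mult_ac)
  next
    case False
    then show ?thesis
      using assms by (simp add: overlay_slope_def)
  qed
  show ?thesis
    using True R1 hat assms by (auto simp: mem_hat_overlay_iff not_less)
qed

lemma underlay_gain_cases:
  assumes "c1 > 0" "c2 > 0" "c3 > 0"
  shows "exp c3 < c1 \<longleftrightarrow> exp (c2 + c3) < c1 \<or> (c1, c2, c3) \<in> hat_underlay"
proof -
  have R1: "exp c3 < c1" if "exp (c2 + c3) < c1"
    using that assms by (smt (verit) exp_less_mono)
  have hat: "underlay_slope (min 1 c2) < exp c3 / c1" if "c1 \<le> exp (c2 + c3)"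
  proof (cases "c2 < 1")
    case True
    have "c1 * exp (- c2) \<le> exp c3"
      using that by (simp add: exp_minus exp_add field_simps)
    then have "c1 * exp (- c2) * (1 - c2) \<le> exp c3 * (1 - c2)"
      using True by (intro mult_right_mono) auto
    also have "\<dots> < exp c3"
      using assms by simp
    finally show ?thesis
      using True assms by (simp add: underlay_slope_def pos_less_divide_eq mult_ac)
  next
    case False
    then show ?thesis
      using assms by (simp add: underlay_slope_def)
  qed
  show ?thesis
    using R1 hat assms by (auto simp: mem_hat_underlay_iff not_less)
qed

section \<open>Existence and uniqueness of the stationary point\<close>

lemma overlay_stationary_ex1:
  assumes "(c1, c2) \<in> hat_overlay"
  shows "\<exists>!x. stationary_overlay (c1, c2) x"
proof -
  have pos: "c1 > 0" "c2 > 0"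
    using assms by (auto simp: hat_overlay_def overlay_points_def)
  have hat: "1 < c2" "c2 / c1 < exp (- 1)" "overlay_slope (min 2 c2) < c2 / c1"
    using assms mem_hat_overlay_iff[OF pos] by auto
  have "\<exists>!x. 1 < x \<and> x < min 2 c2 \<and> overlay_slope x = c2 / c1"
  proof (rule strict_decreasing_unique_root)
    show "continuous_on {1..min 2 c2} overlay_slope"
      unfolding overlay_slope_def by (intro continuous_intros)
    show "c2 / c1 < overlay_slope 1"
      using hat by (simp add: overlay_slope_def)
  qed (use hat overlay_slope_less in auto)
  then show ?thesis
    by (simp add: stationary_overlay_def overlay_slope_def)
qed

lemma underlay_stationary_ex1:
  assumes "(c1, c2, c3) \<in> hat_underlay"
  shows "\<exists>!x. stationary_underlay (c1, c2, c3) x"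
proof -
  have pos: "c1 > 0" "c2 > 0" "c3 > 0"
    using assms by (auto simp: hat_underlay_def underlay_points_def)
  have hat: "exp c3 / c1 < 1" "underlay_slope (min 1 c2) < exp c3 / c1"
    using assms mem_hat_underlay_iff[OF pos] by auto
  have "\<exists>!x. 0 < x \<and> x < min 1 c2 \<and> underlay_slope x = exp c3 / c1"
  proof (rule strict_decreasing_unique_root)
    show "continuous_on {0..min 1 c2} underlay_slope"
      unfolding underlay_slope_def by (intro continuous_intros)
    show "exp c3 / c1 < underlay_slope 0"
      using hat by (simp add: underlay_slope_def)
  qed (use hat pos underlay_slope_less in auto)
  then show ?thesis
    by (simp add: stationary_underlay_def underlay_slope_def)
qed

section \<open>Maximizing probabilities\<close>

lemma overlay_maximizer:
  assumes "R0 > 0" "w > 0" and pos: "c1 > 0" "c2 > 0"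
    and "c2 / c1 < min 1 c2 * exp (- min 1 c2)"
    and "min 1 c2 \<le> x" "x \<le> c2" "x \<le> 2"
    and "c2 / c1 \<le> overlay_slope x" "x < c2 \<Longrightarrow> overlay_slope x = c2 / c1"
  shows "rate_maximizers R0 w (f_overlay (c1, c2)) = {x / c2}"
proof (rule rate_maximizers_rescale[where A = "c1 / c2\<^sup>2"
      and H = "\<lambda>x. x\<^sup>2 * exp (- x) - c2 / c1 * x"])
  show "f_overlay (c1, c2) p =
    c1 / c2\<^sup>2 * ((c2 * p)\<^sup>2 * exp (- (c2 * p)) - c2 / c1 * (c2 * p))" for p
    by (rule f_overlay_rescale[OF pos])
qed (use assms overlay_peak[OF assms(5-10)] in \<open>auto simp del: times_divide_eq_left\<close>)

lemma underlay_maximizer: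
  assumes "R0 > 0" "w > 0" and pos: "c1 > 0" "c2 > 0"
    and "0 < x" "x \<le> c2" "x \<le> 1"
    and "exp c3 / c1 \<le> underlay_slope x" "x < c2 \<Longrightarrow> underlay_slope x = exp c3 / c1"
  shows "rate_maximizers R0 w (f_underlay (c1, c2, c3)) = {x / c2}"
proof (rule rate_maximizers_rescale[where A = "c1 * exp (- c3) / c2"
      and H = "\<lambda>x. x * exp (- x) - exp c3 / c1 * x"])
  show "f_underlay (c1, c2, c3) p =
    c1 * exp (- c3) / c2 * ((c2 * p) * exp (- (c2 * p)) - exp c3 / c1 * (c2 * p))" for p
    by (rule f_underlay_rescale[OF pos])
qed (use assms underlay_peak[OF less_imp_le[OF assms(5)] assms(7-9)] in \<open>auto simp del: times_divide_eq_left\<close>)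

lemma overlay_maximizer_hat:
  assumes "R0 > 0" "w > 0" "(c1, c2) \<in> hat_overlay" "stationary_overlay (c1, c2) x"
  shows "rate_maximizers R0 w (f_overlay (c1, c2)) = {x / c2}" "x / c2 < 1"
proof -
  have pos: "c1 > 0" "c2 > 0"
    using assms by (auto simp: hat_overlay_def overlay_points_def)
  have x: "1 < x" "x < 2" "x < c2" "overlay_slope x = c2 / c1"
    using assms(4) by (auto simp: stationary_overlay_def overlay_slope_def)
  show "rate_maximizers R0 w (f_overlay (c1, c2)) = {x / c2}"
    using assms(1-3) pos x overlay_gain_cases[OF pos] by (intro overlay_maximizer) auto
  show "x / c2 < 1"
    using x pos by simp
qed

lemma underlay_maximizer_hat:
  assumes "R0 > 0" "w > 0" "(c1, c2, c3) \<in> hat_underlay" "stationary_underlay (c1, c2, c3) x"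
  shows "rate_maximizers R0 w (f_underlay (c1, c2, c3)) = {x / c2}" "x / c2 < 1"
proof -
  have pos: "c1 > 0" "c2 > 0"
    using assms by (auto simp: hat_underlay_def underlay_points_def)
  have x: "0 < x" "x < 1" "x < c2" "underlay_slope x = exp c3 / c1"
    using assms(4) by (auto simp: stationary_underlay_def underlay_slope_def)
  show "rate_maximizers R0 w (f_underlay (c1, c2, c3)) = {x / c2}"
    using assms(1,2) pos x by (intro underlay_maximizer) auto
  show "x / c2 < 1"
    using x pos by simp
qed

lemma overlay_maximizer_not_hat:
  assumes "R0 > 0" "w > 0" and pos: "c1 > 0" "c2 > 0"
    and gain: "c2 / c1 < min 1 c2 * exp (- min 1 c2)" and "(c1, c2) \<notin> hat_overlay"
  shows "rate_maximizers R0 w (f_overlay (c1, c2)) = {1}"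
proof -
  have "c2 \<le> 2 \<and> c2 / c1 \<le> overlay_slope c2"
  proof (cases "1 < c2")
    case True
    \<comment> \<open>With \<open>c2 > 1\<close> the gain condition is
      \<open>c2 / c1 < exp (- 1)\<close>, so it must be the slope condition of the hat region that
      fails.\<close>
    then have slope: "c2 / c1 \<le> overlay_slope (min 2 c2)"
      using gain \<open>(c1, c2) \<notin> hat_overlay\<close> mem_hat_overlay_iff[OF pos] by auto
    moreover have "overlay_slope 2 < c2 / c1"
      using pos by (simp add: overlay_slope_def)
    ultimately show ?thesis
      by (auto simp: min_def split: if_splits)
  next
    case False
    \<comment> \<open>For \<open>c2 <= 1\<close> the factor \<open>2 - c2\<close> is at least
      \<open>1\<close>, so the slope at \<open>c2\<close> dominates the quantity in
      \<open>gain\<close>.\<close>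
    have "c2 * exp (- c2) * 1 \<le> c2 * exp (- c2) * (2 - c2)"
      using False pos by (intro mult_left_mono) auto
    then show ?thesis
      using False gain by (simp add: overlay_slope_def)
  qed
  then have "rate_maximizers R0 w (f_overlay (c1, c2)) = {c2 / c2}"
    using assms by (intro overlay_maximizer) auto
  then show ?thesis
    using pos by simp
qed

lemma underlay_maximizer_not_hat:
  assumes "R0 > 0" "w > 0" and pos: "c1 > 0" "c2 > 0" "c3 > 0"
    and gain: "exp c3 < c1" and "(c1, c2, c3) \<notin> hat_underlay"
  shows "rate_maximizers R0 w (f_underlay (c1, c2, c3)) = {1}"
proof -
  have "exp c3 / c1 \<le> underlay_slope (min 1 c2)"
    using assms(7) gain pos mem_hat_underlay_iff[OF pos] by auto
  \<comment> \<open>The slope vanishes at \<open>1\<close>, which rules out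
    \<open>min 1 c2 = 1\<close> unless \<open>c2 = 1\<close>, and that value is excluded by the same
    comparison.\<close>
  moreover have "underlay_slope 1 < exp c3 / c1"
    using pos by (simp add: underlay_slope_def)
  ultimately have "c2 \<le> 1 \<and> exp c3 / c1 \<le> underlay_slope c2"
    by (auto simp: min_def split: if_splits)
  then have "rate_maximizers R0 w (f_underlay (c1, c2, c3)) = {c2 / c2}"
    using assms by (intro underlay_maximizer) auto
  then show ?thesis
    using pos by simp
qed

section \<open>Regions and optimal probabilities combined\<close>

theorem proposition5:
  fixes R0o wo :: "real \<times> real \<Rightarrow> real"
    and R0u wu :: "real \<times> real \<times> real \<Rightarrow> real"
  assumes "\<And>\<theta>. \<theta> \<in> overlay_points \<Longrightarrow> R0o \<theta> > 0 \<and> wo \<theta> > 0"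
    and "\<And>\<theta>. \<theta> \<in> underlay_points \<Longrightarrow> R0u \<theta> > 0 \<and> wu \<theta> > 0"
  shows
    "(let R3p = region_3p overlay_points R0o wo f_overlay;
          R1 = region_baseline overlay_points R0o wo f_overlay;
          pstar = (\<lambda>\<theta>. rate_maximizers (R0o \<theta>) (wo \<theta>) (f_overlay \<theta>))
      in R3p = R1 \<union> hat_overlay \<and>
         R1 = {(c1, c2) \<in> overlay_points. c1 > exp c2} \<and>
         (\<forall>(c1, c2) \<in> hat_overlay.
            (\<exists>!x. stationary_overlay (c1, c2) x) \<and>
            (\<forall>x. stationary_overlay (c1, c2) x \<longrightarrow>
                 pstar (c1, c2) = {x / c2} \<and> x / c2 < 1)) \<and>
         (\<forall>\<theta> \<in> R3p - hat_overlay. pstar \<theta> = {1}))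
     \<and>
     (let R3p = region_3p underlay_points R0u wu f_underlay;
          R1 = region_baseline underlay_points R0u wu f_underlay;
          pstar = (\<lambda>\<theta>. rate_maximizers (R0u \<theta>) (wu \<theta>) (f_underlay \<theta>))
      in R3p = R1 \<union> hat_underlay \<and>
         R1 = {(c1, c2, c3) \<in> underlay_points. c1 > exp (c2 + c3)} \<and>
         (\<forall>(c1, c2, c3) \<in> hat_underlay.
            (\<exists>!x. stationary_underlay (c1, c2, c3) x) \<and>
            (\<forall>x. stationary_underlay (c1, c2, c3) x \<longrightarrow>
                 pstar (c1, c2, c3) = {x / c2} \<and> x / c2 < 1)) \<and>
         (\<forall>\<theta> \<in> R3p - hat_underlay. pstar \<theta> = {1}))"
proof -
  let ?O3 = "region_3p overlay_points R0o wo f_overlay"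
  let ?O1 = "region_baseline overlay_points R0o wo f_overlay"
  let ?U3 = "region_3p underlay_points R0u wu f_underlay"
  let ?U1 = "region_baseline underlay_points R0u wu f_underlay"
  have hatO: "hat_overlay \<subseteq> overlay_points"
    by (auto simp: hat_overlay_def)
  have hatU: "hat_underlay \<subseteq> underlay_points"
    by (auto simp: hat_underlay_def)
  \<comment> \<open>\<open>P\<close> stays free, so that one fact serves both the baseline set
    \<open>{1}\<close> and the full range \<open>{0<..1}\<close>.\<close>
  have regO: "operational_region P overlay_points R0o wo f =
      {\<theta> \<in> overlay_points. \<exists>p\<in>P. f \<theta> p > 0}" for P f
    by (rule operational_region_gain) (rule assms(1))
  have regU: "operational_region P underlay_points R0u wu f =
      {\<theta> \<in> underlay_points. \<exists>p\<in>P. f \<theta> p > 0}" for P f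
    by (rule operational_region_gain) (rule assms(2))
  have O1: "?O1 = {(c1, c2) \<in> overlay_points. c1 > exp c2}"
    unfolding regO
    by (auto simp: f_overlay_one_pos_iff simp del: f_overlay.simps)
  have U1: "?U1 = {(c1, c2, c3) \<in> underlay_points. c1 > exp (c2 + c3)}"
    unfolding regU
    by (auto simp: f_underlay_one_pos_iff simp del: f_underlay.simps)
  have O3: "?O3 = {(c1, c2) \<in> overlay_points. c2 / c1 < min 1 c2 * exp (- min 1 c2)}"
    unfolding regO
    using f_overlay_gain_iff by (auto simp: overlay_points_def simp del: f_overlay.simps)
  have U3: "?U3 = {(c1, c2, c3) \<in> underlay_points. exp c3 < c1}"
    unfolding regU
    using f_underlay_gain_iff by (auto simp: underlay_points_def simp del: f_underlay.simps)
  have "?O3 = ?O1 \<union> hat_overlay"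
    unfolding O1 O3 using hatO overlay_gain_cases by (auto simp: overlay_points_def)
  moreover have "?U3 = ?U1 \<union> hat_underlay"
    unfolding U1 U3 using hatU underlay_gain_cases by (auto simp: underlay_points_def)
  moreover have "\<forall>(c1, c2) \<in> hat_overlay. (\<exists>!x. stationary_overlay (c1, c2) x) \<and>
      (\<forall>x. stationary_overlay (c1, c2) x \<longrightarrow>
        rate_maximizers (R0o (c1, c2)) (wo (c1, c2)) (f_overlay (c1, c2)) = {x / c2} \<and>
        x / c2 < 1)"
  proof clarify
    fix c1 c2 assume hat: "(c1, c2) \<in> hat_overlay"
    then have "R0o (c1, c2) > 0" "wo (c1, c2) > 0"
      using hatO assms(1) by auto
    then show "(\<exists>!x. stationary_overlay (c1, c2) x) \<and>
      (\<forall>x. stationary_overlay (c1, c2) x \<longrightarrow>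
        rate_maximizers (R0o (c1, c2)) (wo (c1, c2)) (f_overlay (c1, c2)) = {x / c2} \<and>
        x / c2 < 1)"
      using hat overlay_stationary_ex1 overlay_maximizer_hat by simp
  qed
  moreover have "\<forall>(c1, c2, c3) \<in> hat_underlay. (\<exists>!x. stationary_underlay (c1, c2, c3) x) \<and>
      (\<forall>x. stationary_underlay (c1, c2, c3) x \<longrightarrow>
        rate_maximizers (R0u (c1, c2, c3)) (wu (c1, c2, c3)) (f_underlay (c1, c2, c3)) = {x / c2} \<and>
        x / c2 < 1)"
  proof clarify
    fix c1 c2 c3 assume hat: "(c1, c2, c3) \<in> hat_underlay"
    then have "R0u (c1, c2, c3) > 0" "wu (c1, c2, c3) > 0"
      using hatU assms(2) by auto
    then show "(\<exists>!x. stationary_underlay (c1, c2, c3) x) \<and>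
      (\<forall>x. stationary_underlay (c1, c2, c3) x \<longrightarrow>
        rate_maximizers (R0u (c1, c2, c3)) (wu (c1, c2, c3)) (f_underlay (c1, c2, c3)) = {x / c2} \<and>
        x / c2 < 1)"
      using hat underlay_stationary_ex1 underlay_maximizer_hat by simp
  qed
  moreover have "\<forall>\<theta> \<in> ?O3 - hat_overlay.
      rate_maximizers (R0o \<theta>) (wo \<theta>) (f_overlay \<theta>) = {1}"
  proof clarify
    fix c1 c2 assume "(c1, c2) \<in> ?O3" "(c1, c2) \<notin> hat_overlay"
    then show "rate_maximizers (R0o (c1, c2)) (wo (c1, c2)) (f_overlay (c1, c2)) = {1}"
      using assms(1)[of "(c1, c2)"] unfolding O3
      by (intro overlay_maximizer_not_hat) (auto simp: overlay_points_def)
  qed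
  moreover have "\<forall>\<theta> \<in> ?U3 - hat_underlay.
      rate_maximizers (R0u \<theta>) (wu \<theta>) (f_underlay \<theta>) = {1}"
  proof clarify
    fix c1 c2 c3 assume "(c1, c2, c3) \<in> ?U3" "(c1, c2, c3) \<notin> hat_underlay"
    then show "rate_maximizers (R0u (c1, c2, c3)) (wu (c1, c2, c3))
        (f_underlay (c1, c2, c3)) = {1}"
      using assms(2)[of "(c1, c2, c3)"] unfolding U3
      by (intro underlay_maximizer_not_hat) (auto simp: underlay_points_def)
  qed
  ultimately show ?thesis
    unfolding Let_def using O1 U1 by (intro conjI)
qed

end
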